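(* (ZFC) Let $\lambda$ be a cardinal such that $\lambda=2^{\mu}$ for some cardinal $\mu$, and such that $\lambda$ is smaller than the first measurable cardinal (i.e. no cardinal $\kappa\le\lambda$ is measurable). Then $\boxplus(\lambda)$ holds: there are a Boolean algebra $\mathbb{B}\subseteq\mathcal{P}(\lambda)$ (a subalgebra of the power set algebra) with $|\mathbb{B}|=\lambda$ and a set $\mathcal{A}\subseteq{}^{\omega}\mathbb{B}$ of $\omega$-sequences of elements of $\mathbb{B}$ such that (i) $|\mathcal{A}|=\lambda$, and for every $\langle A_n:n\in\omega\rangle\in\mathcal{A}$ and every $\alpha<\lambda$, $\alpha\notin A_n$ for all but finitely many $n$; (ii) $\mathbb{B}$ contains all finite subsets of $\lambda$, and for every ultrafilter $D$ of $\mathbb{B}$ containing no finite set (equivalently, for every non-principal ultrafilter $D$ on $\lambda$) there is a sequence $\langle A_n:n\in\omega\rangle\in\mathcal{A}$ such that $A_n\in D$ for infinitely many $n$.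
   Formalization: The cardinal λ is assumed infinite: for finite λ, containing all finite subsets forces 𝔹 = P(λ), so |𝔹| = 2^λ ≠ λ and the claim fails (e.g. λ = 1 = 2^0); clause (ii) is stated for ultrafilters of 𝔹 containing no finite set. *)

theory Defs
  imports "HOL-Analysis.Sigma_Algebra"
begin

unbundle cardinal_syntax

text \<open>
  A cardinal is a relation \<open>r\<close> with \<open>Card_order r\<close>; its elements (the ordinals below it) are the
  elements of \<open>Field r\<close>. Boolean subalgebras of the power set of \<open>X\<close> are given by the
  library predicate \<open>algebra X B\<close>.
\<close>

definition ultrafilter_of :: "'a set \<Rightarrow> 'a set set \<Rightarrow> 'a set set \<Rightarrow> bool" where
  "ultrafilter_of X B D \<longleftrightarrow>
     D \<subseteq> B \<and> X \<in> D \<and> {} \<notin> D \<and>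
     (\<forall>P\<in>D. \<forall>Q\<in>D. P \<inter> Q \<in> D) \<and>
     (\<forall>P\<in>D. \<forall>Q\<in>B. P \<subseteq> Q \<longrightarrow> Q \<in> D) \<and>
     (\<forall>P\<in>B. P \<in> D \<or> X - P \<in> D)"

definition measurable_cardinal :: "'a rel \<Rightarrow> bool" where
  "measurable_cardinal \<kappa> \<longleftrightarrow>
     Card_order \<kappa> \<and> natLeq <o \<kappa> \<and>
     (\<exists>U. ultrafilter_of (Field \<kappa>) (Pow (Field \<kappa>)) U \<and>
          (\<forall>x\<in>Field \<kappa>. U \<noteq> {P. P \<subseteq> Field \<kappa> \<and> x \<in> P}) \<and>
          (\<forall>S. S \<subseteq> U \<and> S \<noteq> {} \<and> |S| <o \<kappa> \<longrightarrow> \<Inter>S \<in> U))"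

definition boxplus :: "'a rel \<Rightarrow> bool" where
  "boxplus l \<longleftrightarrow>
     (\<exists>(B :: 'a set set) (\<A> :: (nat \<Rightarrow> 'a set) set).
        algebra (Field l) B \<and> |B| =o l \<and>
        \<A> \<subseteq> {A. \<forall>n. A n \<in> B} \<and>
        |\<A>| =o l \<and>
        (\<forall>A\<in>\<A>. \<forall>\<alpha>\<in>Field l. \<forall>\<^sub>\<infinity>n. \<alpha> \<notin> A n) \<and>
        (\<forall>F. F \<subseteq> Field l \<and> finite F \<longrightarrow> F \<in> B) \<and>
        (\<forall>D. ultrafilter_of (Field l) B D \<and> (\<forall>P\<in>D. infinite P) \<longrightarrow>
             (\<exists>A\<in>\<A>. \<exists>\<^sub>\<infinity>n. A n \<in> D)))"

end

theory Submission
  imports Defs "HOL-Library.Countable_Set_Type" "HOL-Algebra.Free_Abelian_Groups"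
begin

text \<open>
  Identify \<open>\<lambda>\<close> with the power set of a set \<open>M\<close> of size \<open>\<mu>\<close>, and for distinct \<open>x\<close>, \<open>y\<close> choose a point
  \<open>d x y\<close> of \<open>M\<close> at which they differ. Let \<open>B\<close> be generated by the singletons, the clopen sets
  \<open>{y. m \<in> y}\<close>, and all sets \<open>{y \<noteq> x. d x y \<in> S}\<close> with \<open>S \<subseteq> M\<close>, and let \<open>\<A>\<close> consist of all
  point-finite sequences in \<open>B\<close>; since \<open>\<lambda>\<^sup>\<omega> = \<lambda>\<close>, both have size \<open>\<lambda>\<close>. A nonprincipal
  ultrafilter \<open>D\<close> of \<open>B\<close> decides every clopen set and so converges to some \<open>x\<close>. Its image under
  \<open>d x\<close> is a nonprincipal ultrafilter on the full power set of \<open>M\<close>, because on the fibre of \<open>m\<close>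
  all \<open>y\<close> disagree with \<open>x\<close> at \<open>m\<close>. As there is no measurable cardinal up to \<open>\<mu>\<close>, the image is not
  countably complete, and pulling back a witnessing sequence gives a member of \<open>\<A>\<close>.
\<close>

section \<open>Incomplete ultrafilters below the first measurable cardinal\<close>

text \<open>Preimages commute with intersections and complements. Only preimages under
  \<open>f\<close> need lie in \<open>B\<close>, so an ultrafilter on a small algebra can have an
  image deciding every subset of \<open>K\<close>; \<open>f\<close> matters only on a set of
  \<open>U\<close>.\<close>

lemma ultrafilter_of_vimage:
  assumes U: "ultrafilter_of Y B U" and f: "f \<in> Y0 \<rightarrow> K" and Y0: "Y0 \<in> U"
    and B: "\<And>T. T \<subseteq> K \<Longrightarrow> {y \<in> Y0. f y \<in> T} \<in> B"
  shows "ultrafilter_of K (Pow K) {T. T \<subseteq> K \<and> {y \<in> Y0. f y \<in> T} \<in> U}"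
    (is "ultrafilter_of K _ ?V")
  unfolding ultrafilter_of_def
proof (intro conjI ballI impI)
  have "{y \<in> Y0. f y \<in> K} = Y0" using f by auto
  then show "K \<in> ?V" using Y0 by simp
  show "{} \<notin> ?V" using U by (simp add: ultrafilter_of_def)
next
  fix P Q assume PQ: "P \<in> ?V" "Q \<in> ?V"
  have "{y \<in> Y0. f y \<in> P \<inter> Q} = {y \<in> Y0. f y \<in> P} \<inter> {y \<in> Y0. f y \<in> Q}" by auto
  then show "P \<inter> Q \<in> ?V" using PQ U by (auto simp: ultrafilter_of_def)
next
  fix P Q assume "P \<in> ?V" "Q \<in> Pow K" "P \<subseteq> Q"
  moreover from this have "{y \<in> Y0. f y \<in> P} \<subseteq> {y \<in> Y0. f y \<in> Q}" by auto
  ultimately show "Q \<in> ?V" using U B[of Q] by (auto simp: ultrafilter_of_def)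
next
  fix P assume P: "P \<in> Pow K"
  show "P \<in> ?V \<or> K - P \<in> ?V"
  proof (cases "P \<in> ?V")
    case False
    then have "Y - {y \<in> Y0. f y \<in> P} \<in> U"
      using U P B[of P] by (auto simp: ultrafilter_of_def)
    then have "Y0 \<inter> (Y - {y \<in> Y0. f y \<in> P}) \<in> U"
      using U Y0 by (simp add: ultrafilter_of_def)
    moreover have "Y0 \<inter> (Y - {y \<in> Y0. f y \<in> P}) \<subseteq> {y \<in> Y0. f y \<in> K - P}" using f by auto
    ultimately show ?thesis
      using U B[of "K - P"] by (auto simp: ultrafilter_of_def)
  qed simp
qed auto

text \<open>
  Choose a family \<open>S \<subseteq> U\<close> of least cardinality with \<open>\<Inter>S \<notin> U\<close>, and send each point outside \<open>\<Inter>S\<close> to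
  some member of \<open>S\<close> that misses it; the image of \<open>U\<close> witnesses that \<open>|S|\<close> is measurable.
\<close>

lemma measurable_from_countably_complete:
  fixes L :: "'a set" and M :: "'b set"
  assumes U: "ultrafilter_of M (Pow M) U" and np: "\<And>m. m \<in> M \<Longrightarrow> {m} \<notin> U"
    and cc: "\<And>C. countable C \<Longrightarrow> C \<noteq> {} \<Longrightarrow> C \<subseteq> U \<Longrightarrow> \<Inter>C \<in> U"
    and M_le: "|M| \<le>o |L|"
  shows "\<exists>\<kappa> :: 'a rel. Card_order \<kappa> \<and> \<kappa> \<le>o |L| \<and> measurable_cardinal \<kappa>"
proof -
  have U_sub: "P \<subseteq> M" if "P \<in> U" for P using U that by (auto simp: ultrafilter_of_def)
  have U_compl: "M - P \<in> U \<longleftrightarrow> P \<notin> U" if "P \<subseteq> M" for P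
  proof
    assume "M - P \<in> U"
    moreover have "P \<inter> (M - P) = {}" by auto
    ultimately show "P \<notin> U" using U by (metis ultrafilter_of_def)
  qed (use U that in \<open>auto simp: ultrafilter_of_def\<close>)
  define R where "R = {S. S \<subseteq> U \<and> S \<noteq> {} \<and> \<Inter>S \<notin> U}"
  \<comment> \<open>Nonprincipality puts these complements in \<open>U\<close>, and they have empty
    intersection: \<open>R\<close> is nonempty and its least size is at most
    \<open>|M|\<close>.\<close>
  define S0 where "S0 = (\<lambda>m. M - {m}) ` M"
  have "M \<noteq> {}" using U by (auto simp: ultrafilter_of_def)
  then have "\<Inter>S0 = {}" unfolding S0_def by auto
  moreover have "S0 \<subseteq> U" using U_compl np by (auto simp: S0_def)
  moreover have "{} \<notin> U" using U by (simp add: ultrafilter_of_def)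
  moreover have "S0 \<noteq> {}" using \<open>M \<noteq> {}\<close> by (simp add: S0_def)
  ultimately have S0: "S0 \<in> R" by (simp add: R_def)
  have "card_of ` R \<noteq> {}" "\<forall>r \<in> card_of ` R. Card_order r"
    using S0 card_of_Card_order by auto
  from exists_minim_Card_order[OF this]
  obtain S where "S \<in> R" and S_min: "\<And>S'. S' \<in> R \<Longrightarrow> |S| \<le>o |S'|"
    by auto
  then have S: "S \<subseteq> U" "S \<noteq> {}" "\<Inter>S \<notin> U" by (simp_all add: R_def)
  have "|S| \<le>o |S0|" using S_min[OF S0] .
  also have "|S0| \<le>o |M|" unfolding S0_def by (rule card_of_image)
  also note M_le
  finally have SL: "|S| \<le>o |L|" .
  then obtain g where g: "inj_on g S" "g ` S \<subseteq> L"
    using card_of_ordLeq[of S L] by blast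
  \<comment> \<open>A copy of \<open>S\<close> inside \<open>L\<close>, because the measurable
    cardinal has to be a relation on the type of \<open>L\<close>; \<open>e\<close> decodes
    it.\<close>
  define K where "K = g ` S"
  have KS: "|K| =o |S|"
    unfolding K_def using g(1) by (meson card_of_ordIso bij_betw_imageI ordIso_symmetric)
  define e where "e = inv_into S g"
  have e: "e k \<in> S" if "k \<in> K" for k using that unfolding e_def K_def by (rule inv_into_into)
  have e_surj: "\<exists>k\<in>K. e k = P" if "P \<in> S" for P
    using that g(1) by (auto simp: K_def e_def)
  define Y0 where "Y0 = M - \<Inter>S"
  have Y0: "Y0 \<in> U"
  proof -
    have "\<Inter>S \<subseteq> M" using S U_sub by blast
    then show ?thesis using U_compl S(3) by (simp add: Y0_def)
  qed
  have "\<forall>y\<in>Y0. \<exists>k\<in>K. y \<notin> e k" unfolding Y0_def using e_surj by force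
  then obtain f where f: "\<And>y. y \<in> Y0 \<Longrightarrow> f y \<in> K \<and> y \<notin> e (f y)" by metis
  define V where "V = {T. T \<subseteq> K \<and> {y \<in> Y0. f y \<in> T} \<in> U}"
  have V: "ultrafilter_of K (Pow K) V"
    unfolding V_def using f Y0
    by (intro ultrafilter_of_vimage[OF U]) (auto simp: Y0_def)
  have "V \<noteq> {P. P \<subseteq> K \<and> k \<in> P}" if k: "k \<in> K" for k
  proof
    assume "V = {P. P \<subseteq> K \<and> k \<in> P}"
    then have "{k} \<in> V" using k by auto
    then have "{y \<in> Y0. f y \<in> {k}} \<inter> e k \<in> U"
      using e[OF k] S(1) U by (auto simp: V_def ultrafilter_of_def)
    moreover have "{y \<in> Y0. f y \<in> {k}} \<inter> e k = {}" using f by auto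
    ultimately show False using U by (simp add: ultrafilter_of_def)
  qed
  moreover have "\<Inter>W \<in> V" if W: "W \<subseteq> V" "W \<noteq> {}" "|W| <o |K|" for W
  proof -
    \<comment> \<open>Preimages turn \<open>W\<close> into a subfamily of \<open>U\<close> smaller
      than \<open>S\<close>, so minimality of \<open>S\<close> puts its intersection in
      \<open>U\<close>.\<close>
    define W' where "W' = (\<lambda>T. {y \<in> Y0. f y \<in> T}) ` W"
    have W': "W' \<subseteq> U" "W' \<noteq> {}" using W(1,2) by (auto simp: W'_def V_def)
    have "|W'| \<le>o |W|" unfolding W'_def by (rule card_of_image)
    also note W(3)
    also note KS
    finally have "|W'| <o |S|" .
    then have "W' \<notin> R" using S_min not_ordLess_ordLeq by blast
    then have "\<Inter>W' \<in> U" using W' by (simp add: R_def)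
    moreover have "\<Inter>W' = {y \<in> Y0. f y \<in> \<Inter>W}" using W(2) by (auto simp: W'_def)
    moreover have "\<Inter>W \<subseteq> K" using W by (auto simp: V_def)
    ultimately show ?thesis by (simp add: V_def)
  qed
  moreover have "natLeq <o |K|"
  proof -
    have "\<not> countable S" using cc S by blast
    then have "natLeq <o |S|"
      by (simp add: countable_card_le_natLeq natLeq_Well_order)
    then show ?thesis using KS ordIso_symmetric ordLess_ordIso_trans by blast
  qed
  ultimately have "measurable_cardinal |K|"
    unfolding measurable_cardinal_def Field_card_of using V
    by (intro conjI card_of_Card_order exI[of _ V]) auto
  moreover have "|K| \<le>o |L|" using KS SL ordIso_ordLeq_trans by blast
  ultimately show ?thesis using card_of_Card_order by blast
qed

section \<open>Generated algebras\<close>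

text \<open>
  A finite Boolean combination of generators is coded by the finite set \<open>F\<close> of generators involved
  and the set \<open>T\<close> of membership patterns it accepts.
\<close>

definition generated_algebra :: "'a set \<Rightarrow> 'a set set \<Rightarrow> 'a set set" where
  "generated_algebra X G =
     (\<lambda>(F, T). {y \<in> X. {g \<in> F. y \<in> g} \<in> T}) ` (Fpow G \<times> Fpow (Fpow G))"

lemma generated_algebraI:
  "F \<subseteq> G \<Longrightarrow> finite F \<Longrightarrow> T \<subseteq> Pow F \<Longrightarrow> A = {y \<in> X. {g \<in> F. y \<in> g} \<in> T}
    \<Longrightarrow> A \<in> generated_algebra X G"
  unfolding generated_algebra_def Fpow_def
  by (rule image_eqI[of _ _ "(F, T)"]) (auto intro: finite_subset)

lemma generated_algebraE:
  assumes "A \<in> generated_algebra X G"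
  obtains F T where "F \<subseteq> G" "finite F" "A = {y \<in> X. {g \<in> F. y \<in> g} \<in> T}"
  using assms unfolding generated_algebra_def Fpow_def by auto

lemma generator_in_generated_algebra:
  assumes "g \<in> G" "g \<subseteq> X" shows "g \<in> generated_algebra X G"
proof (rule generated_algebraI[of "{g}" _ "{{g}}"])
  show "g = {y \<in> X. {g' \<in> {g}. y \<in> g'} \<in> {{g}}}" using assms by auto
qed (use assms in auto)

lemma algebra_generated_algebra: "algebra X (generated_algebra X G)"
  unfolding algebra_iff_Un
proof (intro conjI ballI)
  show "generated_algebra X G \<subseteq> Pow X" by (auto elim: generated_algebraE)
  show "{} \<in> generated_algebra X G" by (rule generated_algebraI[of "{}" _ "{}"]) auto
next
  fix A assume "A \<in> generated_algebra X G"
  then obtain F T where "F \<subseteq> G" "finite F" "A = {y \<in> X. {g \<in> F. y \<in> g} \<in> T}"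
    by (rule generated_algebraE)
  then show "X - A \<in> generated_algebra X G"
    by (intro generated_algebraI[of F _ "Pow F - T"]) auto
next
  fix A B assume AB: "A \<in> generated_algebra X G" "B \<in> generated_algebra X G"
  obtain F T where F: "F \<subseteq> G" "finite F" "A = {y \<in> X. {g \<in> F. y \<in> g} \<in> T}"
    using AB(1) by (rule generated_algebraE)
  obtain F' T' where F': "F' \<subseteq> G" "finite F'" "B = {y \<in> X. {g \<in> F'. y \<in> g} \<in> T'}"
    using AB(2) by (rule generated_algebraE)
  have *: "{g \<in> F \<union> F'. y \<in> g} \<inter> F = {g \<in> F. y \<in> g}"
    "{g \<in> F \<union> F'. y \<in> g} \<inter> F' = {g \<in> F'. y \<in> g}" for y by auto
  show "A \<union> B \<in> generated_algebra X G"
  proof (rule generated_algebraI[of "F \<union> F'"])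
    \<comment> \<open>A pattern over \<open>F \<union> F'\<close> is accepted when its trace on
      \<open>F\<close> or on \<open>F'\<close> is.\<close>
    show "A \<union> B = {y \<in> X. {g \<in> F \<union> F'. y \<in> g} \<in> {Z \<in> Pow (F \<union> F'). Z \<inter> F \<in> T \<or> Z \<inter> F' \<in> T'}}"
      unfolding mem_Collect_eq * F(3) F'(3) by auto
  qed (use F F' in auto)
qed

text \<open>An infinite set has as many finite subsets as elements; applying this twice counts the
  codes \<open>(F, T)\<close>.\<close>

lemma card_of_generated_algebra:
  assumes "infinite G" shows "|generated_algebra X G| \<le>o |G|"
proof -
  have F1: "|Fpow G| =o |G|" using assms by simp
  then have inf: "infinite (Fpow G)" using assms card_of_ordIso_finite by blast
  then have F2: "|Fpow (Fpow G)| =o |G|"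
    using F1 card_of_Fpow_infinite ordIso_transitive by blast
  have "|generated_algebra X G| \<le>o |Fpow G \<times> Fpow (Fpow G)|"
    unfolding generated_algebra_def by (rule card_of_image)
  also have "|Fpow G \<times> Fpow (Fpow G)| \<le>o |G|"
    by (rule card_of_Times_ordLeq_infinite_Field)
      (use assms F1 F2 in \<open>auto intro: ordIso_imp_ordLeq\<close>)
  finally show ?thesis .
qed

section \<open>The construction\<close>

text \<open>With \<open>M\<close> infinite, countable powers are absorbed:
  \<open>(2^|M|)^\<omega> = 2^(|M| * \<omega>) = 2^|M|\<close>. This bounds the size of
  \<open>\<A>\<close>.\<close>

lemma card_of_sequences:
  fixes X :: "'a set" and M :: "'b set" and B :: "'c set"
  assumes M: "infinite M" and X: "|X| =o |Pow M|" and B: "|B| \<le>o |X|"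
  shows "|{A :: nat \<Rightarrow> 'c. \<forall>n. A n \<in> B}| \<le>o |X|"
proof -
  have X2: "|X| =o ctwo ^c |M|"
    using X card_of_Pow_Func ordIso_transitive unfolding cexp_def ctwo_def by fastforce
  have "{A :: nat \<Rightarrow> 'c. \<forall>n. A n \<in> B} = Func (Field natLeq) (Field |B| )"
    by (auto simp: Func_def Field_natLeq)
  then have "|{A :: nat \<Rightarrow> 'c. \<forall>n. A n \<in> B}| = |B| ^c natLeq" by (simp add: cexp_def)
  also have "|B| ^c natLeq \<le>o (ctwo ^c |M| ) ^c natLeq"
    by (rule cexp_mono1[OF ordLeq_ordIso_trans[OF B X2] natLeq_Card_order])
  also have "(ctwo ^c |M| ) ^c natLeq =o ctwo ^c |M|"
  proof (rule cexp_cprod_ordLeq)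
    show "Cinfinite |M|" using M by (simp add: cinfinite_def)
    show "Cnotzero natLeq" by (intro Cinfinite_Cnotzero conjI natLeq_cinfinite natLeq_Card_order)
    show "natLeq \<le>o |M|" using M infinite_iff_natLeq_ordLeq by blast
  qed (rule Card_order_ctwo)
  also have "ctwo ^c |M| =o |X|" using X2 by (rule ordIso_symmetric)
  finally show ?thesis .
qed

text \<open>The combinatorial core: measurability enters only through the incompleteness of
  nonprincipal ultrafilters on \<open>M\<close>.\<close>

lemma boxplus_of_bij_Pow:
  fixes l :: "'a rel" and M :: "'b set"
  assumes l: "Card_order l" and M: "infinite M" and h: "bij_betw h (Field l) (Pow M)"
    and incomplete: "\<And>U. ultrafilter_of M (Pow M) U \<Longrightarrow> (\<And>m. m \<in> M \<Longrightarrow> {m} \<notin> U)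
      \<Longrightarrow> \<exists>C. countable C \<and> C \<noteq> {} \<and> C \<subseteq> U \<and> \<Inter>C \<notin> U"
  shows "boxplus l"
proof -
  define X where "X = Field l"
  have h: "bij_betw h X (Pow M)" using h by (simp add: X_def)
  have Xl: "|X| =o l" unfolding X_def using l by (rule card_of_Field_ordIso)
  have XP: "|X| =o |Pow M|" using h card_of_ordIso by blast
  have MX: "|M| \<le>o |X|"
    using card_of_Pow[of M] XP ordIso_symmetric ordLess_imp_ordLeq ordLeq_ordIso_trans by blast
  have X: "infinite X" using MX M card_of_ordLeq_infinite by blast
  have "\<exists>m\<in>M. m \<in> h x \<longleftrightarrow> m \<notin> h y" if "x \<in> X" "y \<in> X" "y \<noteq> x" for x y
  proof -
    have "h x \<noteq> h y" "h x \<subseteq> M" "h y \<subseteq> M"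
      using h that by (auto simp: bij_betw_def inj_on_def)
    then show ?thesis by blast
  qed
  then obtain d where d: "\<And>x y. x \<in> X \<Longrightarrow> y \<in> X \<Longrightarrow> y \<noteq> x \<Longrightarrow> d x y \<in> M \<and> (d x y \<in> h x \<longleftrightarrow> d x y \<notin> h y)"
    by metis
  define E where "E m = {y \<in> X. m \<in> h y}" for m
  define N where "N x S = {y \<in> X - {x}. d x y \<in> S}" for x S
  define G where "G = (\<lambda>x. {x}) ` X \<union> E ` M \<union> (\<lambda>(x, S). N x S) ` (X \<times> Pow M)"
  define B where "B = generated_algebra X G"
  define \<A> where "\<A> = {A :: nat \<Rightarrow> 'a set. (\<forall>n. A n \<in> B) \<and> (\<forall>\<alpha>\<in>X. \<forall>\<^sub>\<infinity>n. \<alpha> \<notin> A n)}"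
  have alg: "algebra X B" unfolding B_def by (rule algebra_generated_algebra)
  have sing_B: "{x} \<in> B" if "x \<in> X" for x
    unfolding B_def using that by (auto intro!: generator_in_generated_algebra simp: G_def)
  have N_B: "N x S \<in> B" if "x \<in> X" "S \<subseteq> M" for x S
    unfolding B_def using that
    by (auto intro!: generator_in_generated_algebra simp: G_def N_def)
  have E_B: "E m \<in> B" if "m \<in> M" for m
    unfolding B_def using that by (auto intro!: generator_in_generated_algebra simp: G_def E_def)
  have inj: "inj_on (\<lambda>x. {x}) X" by (simp add: inj_on_def)
  have "infinite ((\<lambda>x. {x}) ` X)" using X finite_imageD[OF _ inj] by blast
  then have G_inf: "infinite G" by (simp add: G_def)
  have "|G| \<le>o |X|"
  proof -
    have "|(\<lambda>x. {x}) ` X| \<le>o |X|" by (rule card_of_image)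
    moreover have "|E ` M| \<le>o |X|" using card_of_image MX by (rule ordLeq_transitive)
    moreover have "|X \<times> Pow M| \<le>o |X|"
      by (rule card_of_Times_ordLeq_infinite_Field)
        (use X XP ordIso_symmetric in \<open>auto intro: ordIso_imp_ordLeq\<close>)
    then have "|(\<lambda>(x, S). N x S) ` (X \<times> Pow M)| \<le>o |X|"
      using card_of_image ordLeq_transitive by blast
    ultimately show ?thesis 
      unfolding G_def using X by (intro card_of_Un_ordLeq_infinite_Field) auto
  qed
  then have BX: "|B| \<le>o |X|"
    unfolding B_def using card_of_generated_algebra[OF G_inf] ordLeq_transitive by blast
  moreover have "|X| \<le>o |B|"
    using card_of_ordLeq[of X B] inj sing_B by blast
  ultimately have B: "|B| =o l" using Xl ordIso_iff_ordLeq ordIso_transitive by blast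
  have "|\<A>| \<le>o |{A :: nat \<Rightarrow> 'a set. \<forall>n. A n \<in> B}|" by (rule card_of_mono1) (auto simp: \<A>_def)
  then have "|\<A>| \<le>o |X|" using card_of_sequences[OF M XP BX] ordLeq_transitive by blast
  moreover have "|X| \<le>o |\<A>|"
  proof -
    \<comment> \<open>The sequences \<open>{x}, {}, {}, ...\<close> are trivially point-finite and
      embed \<open>X\<close> into \<open>\<A>\<close>.\<close>
    define s where "s x = (\<lambda>n::nat. if n = 0 then {x} else {})" for x :: 'a
    have "{} \<in> B" using alg by (simp add: algebra_iff_Un)
    moreover have "\<forall>\<^sub>\<infinity>n. \<alpha> \<notin> s x n" for \<alpha> x
      unfolding MOST_nat s_def by (intro exI[of _ 0]) auto
    ultimately have "s ` X \<subseteq> \<A>" using sing_B by (auto simp: \<A>_def s_def)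
    moreover have "inj_on s X" by (rule inj_onI) (auto simp: s_def fun_eq_iff dest: spec[of _ 0])
    ultimately show ?thesis using card_of_ordLeq[of X \<A>] by blast
  qed
  ultimately have A: "|\<A>| =o l" using Xl ordIso_iff_ordLeq ordIso_transitive by blast
  have fin: "F \<in> B" if "finite F" "F \<subseteq> X" for F
    using that
  proof (induction F)
    case empty
    then show ?case using alg by (simp add: algebra_iff_Un)
  next
    case (insert x F)
    then have "{x} \<union> F \<in> B" using alg sing_B unfolding algebra_iff_Un by blast
    then show ?case by simp
  qed
  have "\<exists>A\<in>\<A>. \<exists>\<^sub>\<infinity>n. A n \<in> D" if D: "ultrafilter_of X B D" and D_inf: "\<forall>P\<in>D. infinite P" for D
  proof -
    have D_int: "P \<inter> Q \<in> D" if "P \<in> D" "Q \<in> D" for P Q using D that by (simp add: ultrafilter_of_def)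
    have D_compl: "X - P \<in> D" if "P \<in> B" "P \<notin> D" for P using D that by (auto simp: ultrafilter_of_def)
    have D_empty: "{} \<notin> D" using D by (simp add: ultrafilter_of_def)
    \<comment> \<open>The limit of \<open>D\<close>: the point whose code \<open>h x\<close>
      collects the \<open>m\<close> with \<open>E m\<close> in \<open>D\<close>.\<close>
    define x where "x = inv_into X h {m \<in> M. E m \<in> D}"
    have "{m \<in> M. E m \<in> D} \<in> h ` X" using h by (auto simp: bij_betw_def)
    then have x: "x \<in> X" and hx: "h x = {m \<in> M. E m \<in> D}"
      unfolding x_def by (rule inv_into_into, rule f_inv_into_f)
    define U where "U = {S. S \<subseteq> M \<and> N x S \<in> D}"
    have "{x} \<notin> D" using D_inf by blast
    then have "X - {x} \<in> D" using D_compl sing_B x by blast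
    \<comment> \<open>The image of \<open>D\<close> under \<open>d x\<close> on
      \<open>X - {x}\<close>. All sets \<open>N x S\<close> with \<open>S \<subseteq> M\<close> lie
      in \<open>B\<close>, so \<open>U\<close> decides every subset of \<open>M\<close>.\<close>
    then have U: "ultrafilter_of M (Pow M) U"
      unfolding U_def N_def using d x N_B
      by (intro ultrafilter_of_vimage[OF D]) (auto simp: N_def)
    have "{m} \<notin> U" if m: "m \<in> M" for m
    proof
      assume "{m} \<in> U"
      then have Nm: "N x {m} \<in> D" by (simp add: U_def)
      show False
      proof (cases "E m \<in> D")
        case True
        then have "m \<in> h x" using hx m by simp
        then have "N x {m} \<inter> E m = {}" using d x by (auto simp: N_def E_def)
        then show False using D_int[OF Nm True] D_empty by simp
      next
        case False
        then have "m \<notin> h x" using hx by simp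
        then have "N x {m} \<inter> (X - E m) = {}" using d x by (fastforce simp: N_def E_def)
        then show False using D_int[OF Nm D_compl[OF E_B[OF m] False]] D_empty by simp
      qed
    qed
    then obtain C where C: "countable C" "C \<noteq> {}" "C \<subseteq> U" "\<Inter>C \<notin> U"
      using incomplete[OF U] by blast
    obtain c :: "nat \<Rightarrow> 'b set" where c: "range c = C"
      using C(1,2) by (metis range_from_nat_into)
    \<comment> \<open>Finite intersections stay in \<open>U\<close>, and so does the complement of
      \<open>\<Inter>C\<close>. Removing \<open>\<Inter>C\<close> makes the decreasing sets
      \<open>S n\<close> have empty intersection, hence their pullbacks are point-finite.\<close>
    define S where "S n = (\<Inter>i\<le>n. c i) - \<Inter>C" for n
    have CM: "\<Inter>C \<subseteq> M" using C(2,3) by (auto simp: U_def)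
    have "(\<Inter>i\<le>n. c i) \<in> U" for n
    proof (induction n)
      case 0
      then show ?case using c C(3) by auto
    next
      case (Suc n)
      moreover have "c (Suc n) \<in> U" using c C(3) by auto
      ultimately have "c (Suc n) \<inter> (\<Inter>i\<le>n. c i) \<in> U" using U by (simp add: ultrafilter_of_def)
      then show ?case by (simp add: atMost_Suc)
    qed
    moreover have "M - \<Inter>C \<in> U" using U C(4) CM by (auto simp: ultrafilter_of_def)
    ultimately have "(\<Inter>i\<le>n. c i) \<inter> (M - \<Inter>C) \<in> U" for n
      using U by (simp add: ultrafilter_of_def)
    moreover have "(\<Inter>i\<le>n. c i) \<inter> (M - \<Inter>C) = S n" for n
    proof -
      have "c 0 \<subseteq> M" using c C(3) by (auto simp: U_def)
      then show ?thesis by (auto simp: S_def)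
    qed
    ultimately have S: "S n \<in> U" for n by simp
    have "\<forall>\<^sub>\<infinity>n. y \<notin> N x (S n)" for y
    proof (cases "d x y \<in> \<Inter>C")
      case True
      then show ?thesis by (auto simp: N_def S_def)
    next
      case False
      then obtain i where "d x y \<notin> c i" using c by auto
      then show ?thesis unfolding MOST_nat_le by (intro exI[of _ i]) (auto simp: N_def S_def)
    qed
    moreover have "N x (S n) \<in> D" "N x (S n) \<in> B" for n
      using S[of n] x N_B by (auto simp: U_def)
    ultimately show ?thesis by (intro bexI[of _ "\<lambda>n. N x (S n)"]) (auto simp: \<A>_def)
  qed
  then show ?thesis
    unfolding boxplus_def using alg B A fin
    by (intro exI[of _ B] exI[of _ \<A>]) (auto simp: X_def \<A>_def)
qed

theorem theorem2p2:
  fixes l :: "'a rel" and \<mu> :: "'b rel"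
  assumes "Card_order l" and "infinite (Field l)"
    and "Card_order \<mu>" and "l =o ctwo ^c \<mu>"
    and "\<forall>\<kappa> :: 'a rel. Card_order \<kappa> \<and> \<kappa> \<le>o l \<longrightarrow> \<not> measurable_cardinal \<kappa>"
  shows "boxplus l"
proof -
  define M where "M = Field \<mu>"
  have Ll: "|Field l| =o l" using assms(1) by (rule card_of_Field_ordIso)
  have "|Pow M| =o ctwo ^c \<mu>"
    unfolding cexp_def ctwo_def M_def Field_card_of by (rule card_of_Pow_Func)
  then have LP: "|Field l| =o |Pow M|"
    by (rule ordIso_transitive[OF ordIso_transitive[OF Ll assms(4)] ordIso_symmetric])
  then obtain h where h: "bij_betw h (Field l) (Pow M)" using card_of_ordIso by blast
  have M: "infinite M" using h assms(2) by (auto dest: bij_betw_finite)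
  \<comment> \<open>This lets a measurable cardinal obtained from \<open>M\<close> be realised on
    the type of \<open>l\<close>, where the hypothesis excludes it.\<close>
  have M_le: "|M| \<le>o |Field l|"
    using card_of_Pow[of M] LP ordIso_symmetric ordLess_imp_ordLeq ordLeq_ordIso_trans by blast
  show ?thesis
  proof (rule boxplus_of_bij_Pow[OF assms(1) M h], rule ccontr)
    fix U assume U: "ultrafilter_of M (Pow M) U" "\<And>m. m \<in> M \<Longrightarrow> {m} \<notin> U"
      and "\<nexists>C. countable C \<and> C \<noteq> {} \<and> C \<subseteq> U \<and> \<Inter>C \<notin> U"
    then have "\<exists>\<kappa> :: 'a rel. Card_order \<kappa> \<and> \<kappa> \<le>o |Field l| \<and> measurable_cardinal \<kappa>"
      using M_le by (intro measurable_from_countably_complete[OF U]) auto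
    then show False using assms(5) Ll ordLeq_ordIso_trans by blast
  qed
qed

end
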